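(* Let $(\mathcal V,\otimes,I,\lambda,\rho,\alpha)$ be a monoidal category, let $H:\mathcal V\to\mathcal V$ be an endofunctor, and let $\theta$ be a pointed tensorial strength for $H$. Assume that the underlying category of $\mathcal V$ has binary coproducts and that binary coproducts distribute over the tensor in its second argument, i.e. for all objects $v,w_1,w_2$ of $\mathcal V$ the canonical morphism $[1_v\otimes\mathsf{inl},1_v\otimes\mathsf{inr}]: v\otimes w_1+v\otimes w_2\to v\otimes(w_1+w_2)$ is an isomorphism. Let $(t,\mathsf{out})$, with $\mathsf{out}:t\to I+Ht$, be a final coalgebra of the functor $I+H{-}$ on $\mathcal V$. Then $\mathsf{out}$ is an isomorphism (Lambek); write $\mathsf{out}^{-1}=[\eta,\tau]$ with $\eta:I\to t$ and $\tau:Ht\to t$. Then the triple $(t,\eta,\tau)$ is a monoidal heterogeneous substitution system (MHSS) for $(\mathcal V,H,\theta)$.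
   Context: Composition of morphisms is written in diagrammatic order: for $f:a\to b$ and $g:b\to c$, $f\cdot g:a\to c$. In a monoidal category the unitors and associator have components $\lambda_x:I\otimes x\to x$, $\rho_x:x\otimes I\to x$, $\alpha_{x,y,z}:(x\otimes y)\otimes z\to x\otimes(y\otimes z)$. $\mathsf{inl},\mathsf{inr}$ are the coproduct injections and $[-,-]$ is copairing. Monoidal-pointed objects: the coslice category $I/\mathcal V$ has as objects pairs $(v,p)$ with $v$ an object of $\mathcal V$ and $p:I\to v$; its morphisms are the $\mathcal V$-morphisms commuting with the points. It is monoidal with unit $I^{ptd}:=(I,1_I)$ and tensor $(v,p)\otimes^{ptd}(w,q):=(v\otimes w,\ \lambda_I^{-1}\cdot(p\otimes q))$. Pointed tensorial strength for an endofunctor $H$ on $\mathcal V$: a family $\theta_{(v,p),x}:v\otimes Hx\to H(v\otimes x)$, natural in $(v,p)\in I/\mathcal V$ and in $x\in\mathcal V$, such that for all arguments (i) $\theta_{I^{ptd},x}\cdot H\lambda_x=\lambda_{Hx}$, and (ii) $\theta_{(v,p)\otimes^{ptd}(w,q),x}\cdot H\alpha_{v,w,x}=\alpha_{v,w,Hx}\cdot(1_v\otimes\theta_{(w,q),x})\cdot\theta_{(v,p),w\otimes x}$. MHSS for $(\mathcal V,H,\theta)$: a triple $(t,\eta,\tau)$ with $t$ an object of $\mathcal V$, $\eta:I\to t$ and $\tau:Ht\to t$, such that for every triple $(z,e,f)$ with $z$ an object of $\mathcal V$, $e:I\to z$ and $f:z\to t$ (arbitrary $\mathcal V$-morphisms),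 there is a unique morphism $h:z\otimes t\to t$ with $(1_z\otimes\eta)\cdot h=\rho_z\cdot f$ and $(1_z\otimes\tau)\cdot h=\theta_{(z,e),t}\cdot Hh\cdot\tau$. *)

theory Defs
  imports Main
begin

text \<open>Objects form a set of type \<^typ>\<open>'o set\<close> and morphisms a set of type \<^typ>\<open>'m set\<close>; what the
  operations do outside these sets is irrelevant. Composition is in diagrammatic order.\<close>

record ('o, 'm) cat =
  Obj :: "'o set"
  Arr :: "'m set"
  Dom :: "'m \<Rightarrow> 'o"
  Cod :: "'m \<Rightarrow> 'o"
  ide :: "'o \<Rightarrow> 'm"
  seq :: "'m \<Rightarrow> 'm \<Rightarrow> 'm"  (infixl \<open>\<cdot>\<index>\<close> 55)

definition hom :: "('o, 'm, 's) cat_scheme \<Rightarrow> 'o \<Rightarrow> 'o \<Rightarrow> 'm set" where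
  "hom C a b = {f \<in> Arr C. Dom C f = a \<and> Cod C f = b}"

locale category =
  fixes C :: "('o, 'm, 's) cat_scheme" (structure)
  assumes Dom_in: "f \<in> Arr C \<Longrightarrow> Dom C f \<in> Obj C"
    and Cod_in: "f \<in> Arr C \<Longrightarrow> Cod C f \<in> Obj C"
    and ide_in: "a \<in> Obj C \<Longrightarrow> ide C a \<in> hom C a a"
    and seq_in: "\<lbrakk>f \<in> hom C a b; g \<in> hom C b c\<rbrakk> \<Longrightarrow> f \<cdot> g \<in> hom C a c"
    and ide_left: "f \<in> hom C a b \<Longrightarrow> ide C a \<cdot> f = f"
    and ide_right: "f \<in> hom C a b \<Longrightarrow> f \<cdot> ide C b = f"
    and seq_assoc: "\<lbrakk>f \<in> hom C a b; g \<in> hom C b c; h \<in> hom C c d\<rbrakk>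
      \<Longrightarrow> (f \<cdot> g) \<cdot> h = f \<cdot> (g \<cdot> h)"

definition inverse_arrows :: "('o, 'm, 's) cat_scheme \<Rightarrow> 'm \<Rightarrow> 'm \<Rightarrow> bool" where
  "inverse_arrows C f g \<longleftrightarrow>
     f \<in> Arr C \<and> g \<in> hom C (Cod C f) (Dom C f) \<and>
     f \<cdot> g = ide C (Dom C f) \<and> g \<cdot> f = ide C (Cod C f)"
  for C (structure)

definition is_iso :: "('o, 'm, 's) cat_scheme \<Rightarrow> 'm \<Rightarrow> bool" where
  "is_iso C f \<longleftrightarrow> (\<exists>g. inverse_arrows C f g)"

definition arr_inv :: "('o, 'm, 's) cat_scheme \<Rightarrow> 'm \<Rightarrow> 'm" where
  "arr_inv C f = (THE g. inverse_arrows C f g)"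

record ('o, 'm) endo =
  on_obj :: "'o \<Rightarrow> 'o"
  on_arr :: "'m \<Rightarrow> 'm"

locale endofunctor = category C for C :: "('o, 'm, 's) cat_scheme" (structure) +
  fixes F :: "('o, 'm) endo"
  assumes on_obj_in: "a \<in> Obj C \<Longrightarrow> on_obj F a \<in> Obj C"
    and on_arr_in: "f \<in> hom C a b \<Longrightarrow> on_arr F f \<in> hom C (on_obj F a) (on_obj F b)"
    and on_arr_ide: "a \<in> Obj C \<Longrightarrow> on_arr F (ide C a) = ide C (on_obj F a)"
    and on_arr_seq: "\<lbrakk>f \<in> hom C a b; g \<in> hom C b c\<rbrakk>
      \<Longrightarrow> on_arr F (f \<cdot> g) = on_arr F f \<cdot> on_arr F g"

definition coalgebra :: "('o, 'm, 's) cat_scheme \<Rightarrow> ('o, 'm) endo \<Rightarrow> 'o \<Rightarrow> 'm \<Rightarrow> bool" where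
  "coalgebra C F x c \<longleftrightarrow> x \<in> Obj C \<and> c \<in> hom C x (on_obj F x)"

definition coalgebra_hom ::
  "('o, 'm, 's) cat_scheme \<Rightarrow> ('o, 'm) endo \<Rightarrow> 'o \<Rightarrow> 'm \<Rightarrow> 'o \<Rightarrow> 'm \<Rightarrow> 'm set" where
  "coalgebra_hom C F x c y d = {h \<in> hom C x y. c \<cdot> on_arr F h = h \<cdot> d}"
  for C (structure)

definition final_coalgebra ::
  "('o, 'm, 's) cat_scheme \<Rightarrow> ('o, 'm) endo \<Rightarrow> 'o \<Rightarrow> 'm \<Rightarrow> bool" where
  "final_coalgebra C F t out \<longleftrightarrow>
     coalgebra C F t out \<and>
     (\<forall>x c. coalgebra C F x c \<longrightarrow> (\<exists>!h. h \<in> coalgebra_hom C F x c t out))"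

record ('o, 'm) coprods =
  cop :: "'o \<Rightarrow> 'o \<Rightarrow> 'o"
  inl :: "'o \<Rightarrow> 'o \<Rightarrow> 'm"
  inr :: "'o \<Rightarrow> 'o \<Rightarrow> 'm"

locale binary_coproducts = category C for C :: "('o, 'm, 's) cat_scheme" (structure) +
  fixes K :: "('o, 'm) coprods"
  assumes cop_in: "\<lbrakk>a \<in> Obj C; b \<in> Obj C\<rbrakk> \<Longrightarrow> cop K a b \<in> Obj C"
    and inl_in: "\<lbrakk>a \<in> Obj C; b \<in> Obj C\<rbrakk> \<Longrightarrow> inl K a b \<in> hom C a (cop K a b)"
    and inr_in: "\<lbrakk>a \<in> Obj C; b \<in> Obj C\<rbrakk> \<Longrightarrow> inr K a b \<in> hom C b (cop K a b)"
    and cop_universal: "\<lbrakk>f \<in> hom C a c; g \<in> hom C b c\<rbrakk>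
      \<Longrightarrow> \<exists>!h. h \<in> hom C (cop K a b) c \<and> inl K a b \<cdot> h = f \<and> inr K a b \<cdot> h = g"

definition copair :: "('o, 'm, 's) cat_scheme \<Rightarrow> ('o, 'm) coprods \<Rightarrow> 'm \<Rightarrow> 'm \<Rightarrow> 'm" where
  "copair C K f g = (THE h. h \<in> hom C (cop K (Dom C f) (Dom C g)) (Cod C f) \<and>
     inl K (Dom C f) (Dom C g) \<cdot> h = f \<and> inr K (Dom C f) (Dom C g) \<cdot> h = g)"
  for C (structure)

definition cop_arr :: "('o, 'm, 's) cat_scheme \<Rightarrow> ('o, 'm) coprods \<Rightarrow> 'm \<Rightarrow> 'm \<Rightarrow> 'm" where
  "cop_arr C K f g =
     copair C K (f \<cdot> inl K (Cod C f) (Cod C g)) (g \<cdot> inr K (Cod C f) (Cod C g))"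
  for C (structure)

definition const_plus ::
  "('o, 'm, 's) cat_scheme \<Rightarrow> ('o, 'm) coprods \<Rightarrow> 'o \<Rightarrow> ('o, 'm) endo \<Rightarrow> ('o, 'm) endo" where
  "const_plus C K a F =
     \<lparr>on_obj = (\<lambda>x. cop K a (on_obj F x)),
      on_arr = (\<lambda>f. cop_arr C K (ide C a) (on_arr F f))\<rparr>"

record ('o, 'm) moncat = "('o, 'm) cat" +
  tens :: "'o \<Rightarrow> 'o \<Rightarrow> 'o"  (infixr \<open>\<otimes>\<index>\<close> 70)
  tens_arr :: "'m \<Rightarrow> 'm \<Rightarrow> 'm"  (infixr \<open>\<boxtimes>\<index>\<close> 70)
  unit :: "'o"  (\<open>\<I>\<index>\<close>)
  lunit :: "'o \<Rightarrow> 'm"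
  runit :: "'o \<Rightarrow> 'm"
  associator :: "'o \<Rightarrow> 'o \<Rightarrow> 'o \<Rightarrow> 'm"

locale monoidal_category = category V for V :: "('o, 'm, 's) moncat_scheme" (structure) +
  assumes tens_in: "\<lbrakk>x \<in> Obj V; y \<in> Obj V\<rbrakk> \<Longrightarrow> x \<otimes> y \<in> Obj V"
    and tens_arr_in: "\<lbrakk>f \<in> hom V a b; g \<in> hom V c d\<rbrakk>
      \<Longrightarrow> f \<boxtimes> g \<in> hom V (a \<otimes> c) (b \<otimes> d)"
    and tens_arr_ide: "\<lbrakk>x \<in> Obj V; y \<in> Obj V\<rbrakk> \<Longrightarrow> ide V x \<boxtimes> ide V y = ide V (x \<otimes> y)"
    and interchange: "\<lbrakk>f \<in> hom V a b; g \<in> hom V b c; f' \<in> hom V a' b'; g' \<in> hom V b' c'\<rbrakk>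
      \<Longrightarrow> (f \<cdot> g) \<boxtimes> (f' \<cdot> g') = (f \<boxtimes> f') \<cdot> (g \<boxtimes> g')"
    and unit_in: "\<I> \<in> Obj V"
    and lunit_in: "x \<in> Obj V \<Longrightarrow> lunit V x \<in> hom V (\<I> \<otimes> x) x"
    and lunit_iso: "x \<in> Obj V \<Longrightarrow> is_iso V (lunit V x)"
    and lunit_natural: "f \<in> hom V x y \<Longrightarrow> (ide V \<I> \<boxtimes> f) \<cdot> lunit V y = lunit V x \<cdot> f"
    and runit_in: "x \<in> Obj V \<Longrightarrow> runit V x \<in> hom V (x \<otimes> \<I>) x"
    and runit_iso: "x \<in> Obj V \<Longrightarrow> is_iso V (runit V x)"
    and runit_natural: "f \<in> hom V x y \<Longrightarrow> (f \<boxtimes> ide V \<I>) \<cdot> runit V y = runit V x \<cdot> f"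
    and associator_in: "\<lbrakk>x \<in> Obj V; y \<in> Obj V; z \<in> Obj V\<rbrakk>
      \<Longrightarrow> associator V x y z \<in> hom V ((x \<otimes> y) \<otimes> z) (x \<otimes> (y \<otimes> z))"
    and associator_iso: "\<lbrakk>x \<in> Obj V; y \<in> Obj V; z \<in> Obj V\<rbrakk>
      \<Longrightarrow> is_iso V (associator V x y z)"
    and associator_natural: "\<lbrakk>f \<in> hom V x x'; g \<in> hom V y y'; h \<in> hom V z z'\<rbrakk>
      \<Longrightarrow> ((f \<boxtimes> g) \<boxtimes> h) \<cdot> associator V x' y' z' = associator V x y z \<cdot> (f \<boxtimes> (g \<boxtimes> h))"
    and triangle: "\<lbrakk>x \<in> Obj V; y \<in> Obj V\<rbrakk>
      \<Longrightarrow> associator V x \<I> y \<cdot> (ide V x \<boxtimes> lunit V y) = runit V x \<boxtimes> ide V y"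
    and pentagon: "\<lbrakk>w \<in> Obj V; x \<in> Obj V; y \<in> Obj V; z \<in> Obj V\<rbrakk>
      \<Longrightarrow> associator V (w \<otimes> x) y z \<cdot> associator V w x (y \<otimes> z) =
        (associator V w x y \<boxtimes> ide V z) \<cdot> associator V w (x \<otimes> y) z
          \<cdot> (ide V w \<boxtimes> associator V x y z)"

definition distributes_second ::
  "('o, 'm, 's) moncat_scheme \<Rightarrow> ('o, 'm) coprods \<Rightarrow> bool" where
  "distributes_second V K \<longleftrightarrow>
     (\<forall>v \<in> Obj V. \<forall>w1 \<in> Obj V. \<forall>w2 \<in> Obj V.
        is_iso V (copair V K (ide V v \<boxtimes> inl K w1 w2) (ide V v \<boxtimes> inr K w1 w2)))"
  for V (structure)

text \<open>The coslice category \<open>\<I>/V\<close>: objects are pairs of an object and a point of it. Below, naturality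
  of a strength on \<open>\<I>/V \<times> V\<close> is stated in each variable separately.\<close>

definition ptd_obj :: "('o, 'm, 's) moncat_scheme \<Rightarrow> ('o \<times> 'm) set" where
  "ptd_obj V = {(v, p). v \<in> Obj V \<and> p \<in> hom V \<I> v}"
  for V (structure)

definition ptd_hom :: "('o, 'm, 's) moncat_scheme \<Rightarrow> 'o \<times> 'm \<Rightarrow> 'o \<times> 'm \<Rightarrow> 'm set" where
  "ptd_hom V P Q = {f \<in> hom V (fst P) (fst Q). snd P \<cdot> f = snd Q}"
  for V (structure)

definition ptd_unit :: "('o, 'm, 's) moncat_scheme \<Rightarrow> 'o \<times> 'm" where
  "ptd_unit V = (\<I>, ide V \<I>)"
  for V (structure)

definition ptd_tens :: "('o, 'm, 's) moncat_scheme \<Rightarrow> 'o \<times> 'm \<Rightarrow> 'o \<times> 'm \<Rightarrow> 'o \<times> 'm" where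
  "ptd_tens V P Q = (fst P \<otimes> fst Q, arr_inv V (lunit V \<I>) \<cdot> (snd P \<boxtimes> snd Q))"
  for V (structure)

locale pointed_strength = monoidal_category V + endofunctor V H
  for V :: "('o, 'm, 's) moncat_scheme" (structure) and H :: "('o, 'm) endo" +
  fixes \<theta> :: "'o \<times> 'm \<Rightarrow> 'o \<Rightarrow> 'm"
  assumes strength_in: "\<lbrakk>P \<in> ptd_obj V; x \<in> Obj V\<rbrakk>
      \<Longrightarrow> \<theta> P x \<in> hom V (fst P \<otimes> on_obj H x) (on_obj H (fst P \<otimes> x))"
    and strength_natural_ptd:
      "\<lbrakk>P \<in> ptd_obj V; Q \<in> ptd_obj V; f \<in> ptd_hom V P Q; x \<in> Obj V\<rbrakk>
      \<Longrightarrow> (f \<boxtimes> ide V (on_obj H x)) \<cdot> \<theta> Q x = \<theta> P x \<cdot> on_arr H (f \<boxtimes> ide V x)"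
    and strength_natural:
      "\<lbrakk>P \<in> ptd_obj V; g \<in> hom V x y\<rbrakk>
      \<Longrightarrow> (ide V (fst P) \<boxtimes> on_arr H g) \<cdot> \<theta> P y = \<theta> P x \<cdot> on_arr H (ide V (fst P) \<boxtimes> g)"
    and strength_unit: "x \<in> Obj V
      \<Longrightarrow> \<theta> (ptd_unit V) x \<cdot> on_arr H (lunit V x) = lunit V (on_obj H x)"
    and strength_tens: "\<lbrakk>P \<in> ptd_obj V; Q \<in> ptd_obj V; x \<in> Obj V\<rbrakk>
      \<Longrightarrow> \<theta> (ptd_tens V P Q) x \<cdot> on_arr H (associator V (fst P) (fst Q) x) =
        associator V (fst P) (fst Q) (on_obj H x) \<cdot> (ide V (fst P) \<boxtimes> \<theta> Q x)
          \<cdot> \<theta> P (fst Q \<otimes> x)"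

definition mhss :: "('o, 'm, 's) moncat_scheme \<Rightarrow> ('o, 'm) endo \<Rightarrow> ('o \<times> 'm \<Rightarrow> 'o \<Rightarrow> 'm)
    \<Rightarrow> 'o \<Rightarrow> 'm \<Rightarrow> 'm \<Rightarrow> bool" where
  "mhss V H \<theta> t \<eta> \<tau> \<longleftrightarrow>
     t \<in> Obj V \<and> \<eta> \<in> hom V \<I> t \<and> \<tau> \<in> hom V (on_obj H t) t \<and>
     (\<forall>z \<in> Obj V. \<forall>e \<in> hom V \<I> z. \<forall>f \<in> hom V z t.
        \<exists>!h. h \<in> hom V (z \<otimes> t) t \<and>
             (ide V z \<boxtimes> \<eta>) \<cdot> h = runit V z \<cdot> f \<and>
             (ide V z \<boxtimes> \<tau>) \<cdot> h = \<theta> (z, e) t \<cdot> on_arr H h \<cdot> \<tau>)"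
  for V (structure)

end

theory Submission
  imports Defs
begin

text \<open>The equations for \<open>h\<close> are an instance of primitive corecursion. Distributivity makes
  \<open>k = [1\<^sub>z \<otimes> \<eta>, 1\<^sub>z \<otimes> \<tau>]\<close> an isomorphism, and after composition with \<open>out\<close> the two equations become
  \<open>h \<cdot> out = d \<cdot> (I + H [h, 1\<^sub>t])\<close> for
  \<open>d = k\<^sup>-\<^sup>1 \<cdot> [\<rho>\<^sub>z \<cdot> f \<cdot> out \<cdot> (I + H inr), \<theta> \<cdot> H inl \<cdot> inr]\<close>. The solutions \<open>h\<close> of such an
  equation correspond to the coalgebra morphisms \<open>[h, 1\<^sub>t]\<close> into the final coalgebra, from the
  coalgebra \<open>[d, out \<cdot> (I + H inr)]\<close> on \<open>z \<otimes> t + t\<close>.\<close>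

section \<open>Isomorphisms and cancelling them in equations\<close>

context category
begin

lemma hom_Obj:
  assumes "f \<in> hom C a b"
  shows "a \<in> Obj C" "b \<in> Obj C"
  using assms Dom_in Cod_in by (auto simp: hom_def)

lemma inverse_arrows_hom:
  assumes "f \<in> hom C a b"
  shows "inverse_arrows C f g \<longleftrightarrow> g \<in> hom C b a \<and> f \<cdot> g = ide C a \<and> g \<cdot> f = ide C b"
  using assms by (auto simp: inverse_arrows_def hom_def)

lemma inverse_arrows_unique:
  assumes "inverse_arrows C f g" "inverse_arrows C f g'"
  shows "g = g'"
proof -
  obtain a b where f: "f \<in> hom C a b"
    using assms(1) by (auto simp: inverse_arrows_def hom_def)
  have g: "g \<in> hom C b a" "g \<cdot> f = ide C b" and g': "g' \<in> hom C b a" "f \<cdot> g' = ide C a"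
    using assms inverse_arrows_hom[OF f] by auto
  have "g = g \<cdot> (f \<cdot> g')"
    by (simp add: g'(2) ide_right[OF g(1)])
  also have "\<dots> = g'"
    by (simp add: seq_assoc[OF g(1) f g'(1), symmetric] g(2) ide_left[OF g'(1)])
  finally show ?thesis .
qed

lemma arr_inv_eq: "inverse_arrows C f g \<Longrightarrow> arr_inv C f = g"
  unfolding arr_inv_def by (blast intro: inverse_arrows_unique)

lemma iso_seq:
  assumes f: "f \<in> hom C a b" and g: "g \<in> hom C b c" and "is_iso C f" "is_iso C g"
  shows "is_iso C (f \<cdot> g)"
proof -
  obtain f' where f': "f' \<in> hom C b a" "f \<cdot> f' = ide C a" "f' \<cdot> f = ide C b"
    using assms(3) inverse_arrows_hom[OF f] by (auto simp: is_iso_def)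
  obtain g' where g': "g' \<in> hom C c b" "g \<cdot> g' = ide C b" "g' \<cdot> g = ide C c"
    using assms(4) inverse_arrows_hom[OF g] by (auto simp: is_iso_def)
  have "(f \<cdot> g) \<cdot> (g' \<cdot> f') = f \<cdot> ((g \<cdot> g') \<cdot> f')"
    by (simp add: seq_assoc[OF f g seq_in[OF g'(1) f'(1)]] seq_assoc[OF g g'(1) f'(1)])
  then have 1: "(f \<cdot> g) \<cdot> (g' \<cdot> f') = ide C a"
    by (simp add: f' g' ide_left[OF f'(1)])
  have "(g' \<cdot> f') \<cdot> (f \<cdot> g) = g' \<cdot> ((f' \<cdot> f) \<cdot> g)"
    by (simp add: seq_assoc[OF g'(1) f'(1) seq_in[OF f g]] seq_assoc[OF f'(1) f g])
  then have 2: "(g' \<cdot> f') \<cdot> (f \<cdot> g) = ide C c"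
    by (simp add: f' g' ide_left[OF g])
  show ?thesis
    unfolding is_iso_def inverse_arrows_hom[OF seq_in[OF f g]]
    using 1 2 seq_in[OF g'(1) f'(1)] by blast
qed

text \<open>Cancels \<open>f\<close> against \<open>g\<close>. With the mirror image for composition
  on the right, it moves the inverse of \<open>k\<close> and the map \<open>out\<close> to the
  opposite sides of the corecursion equation.\<close>

lemma inverse_seq_eq_iff:
  assumes f: "f \<in> hom C a b" and g: "g \<in> hom C b a"
    and inv: "f \<cdot> g = ide C a" "g \<cdot> f = ide C b"
    and u: "u \<in> hom C b c" and w: "w \<in> hom C a c"
  shows "u = g \<cdot> w \<longleftrightarrow> f \<cdot> u = w"
proof
  assume "u = g \<cdot> w"
  then show "f \<cdot> u = w"
    by (simp add: seq_assoc[OF f g w, symmetric] inv ide_left[OF w])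
next
  assume "f \<cdot> u = w"
  then show "u = g \<cdot> w"
    using seq_assoc[OF g f u] by (simp add: inv ide_left[OF u])
qed

lemma seq_inverse_eq_iff:
  assumes f: "f \<in> hom C a b" and g: "g \<in> hom C b a"
    and inv: "f \<cdot> g = ide C a" "g \<cdot> f = ide C b"
    and u: "u \<in> hom C c a" and w: "w \<in> hom C c b"
  shows "u \<cdot> f = w \<longleftrightarrow> u = w \<cdot> g"
proof
  assume "u \<cdot> f = w"
  then show "u = w \<cdot> g"
    using seq_assoc[OF u f g] by (simp add: inv ide_right[OF u])
next
  assume "u = w \<cdot> g"
  then show "u \<cdot> f = w"
    by (simp add: seq_assoc[OF w g f] inv ide_right[OF w])
qed

end

section \<open>Copairing and the functor \<open>a + F\<close>\<close>

context binary_coproducts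
begin

lemma
  assumes f: "f \<in> hom C a c" and g: "g \<in> hom C b c"
  shows copair_in: "copair C K f g \<in> hom C (cop K a b) c"
    and inl_copair: "inl K a b \<cdot> copair C K f g = f"
    and inr_copair: "inr K a b \<cdot> copair C K f g = g"
proof -
  have "Dom C f = a" "Dom C g = b" "Cod C f = c"
    using f g by (auto simp: hom_def)
  then have "copair C K f g \<in> hom C (cop K a b) c \<and>
      inl K a b \<cdot> copair C K f g = f \<and> inr K a b \<cdot> copair C K f g = g"
    using theI'[OF cop_universal[OF f g]] by (simp add: copair_def)
  then show "copair C K f g \<in> hom C (cop K a b) c"
      "inl K a b \<cdot> copair C K f g = f" "inr K a b \<cdot> copair C K f g = g"
    by auto
qed

lemma cop_hom_eqI:
  assumes ab: "a \<in> Obj C" "b \<in> Obj C"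
    and h: "h \<in> hom C (cop K a b) c" and h': "h' \<in> hom C (cop K a b) c"
    and "inl K a b \<cdot> h = inl K a b \<cdot> h'" "inr K a b \<cdot> h = inr K a b \<cdot> h'"
  shows "h = h'"
  using cop_universal[OF seq_in[OF inl_in[OF ab] h] seq_in[OF inr_in[OF ab] h]] assms by metis

lemma copair_eqI:
  assumes ab: "a \<in> Obj C" "b \<in> Obj C" and h: "h \<in> hom C (cop K a b) c"
    and "inl K a b \<cdot> h = f" "inr K a b \<cdot> h = g"
  shows "h = copair C K f g"
proof -
  have fg: "f \<in> hom C a c" "g \<in> hom C b c"
    using assms seq_in inl_in[OF ab] inr_in[OF ab] by blast+
  show ?thesis
    by (rule cop_hom_eqI[OF ab h copair_in[OF fg]])
      (simp_all add: assms inl_copair[OF fg] inr_copair[OF fg])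
qed

text \<open>Composing with the two injections recovers the components. This splits a single equation
  between copairings into the two equations of an MHSS.\<close>

lemma copair_eq_iff:
  assumes "f \<in> hom C a c" "g \<in> hom C b c" "f' \<in> hom C a c" "g' \<in> hom C b c"
  shows "copair C K f g = copair C K f' g' \<longleftrightarrow> f = f' \<and> g = g'"
  using inl_copair[OF assms(1,2)] inr_copair[OF assms(1,2)]
    inl_copair[OF assms(3,4)] inr_copair[OF assms(3,4)] by auto

lemma copair_seq:
  assumes f: "f \<in> hom C a c" and g: "g \<in> hom C b c" and h: "h \<in> hom C c d"
  shows "copair C K f g \<cdot> h = copair C K (f \<cdot> h) (g \<cdot> h)"
proof -
  have ab: "a \<in> Obj C" "b \<in> Obj C"
    using hom_Obj f g by auto
  show ?thesis
    by (rule copair_eqI[OF ab seq_in[OF copair_in[OF f g] h]])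
      (simp_all add: seq_assoc[OF inl_in[OF ab] copair_in[OF f g] h, symmetric]
        seq_assoc[OF inr_in[OF ab] copair_in[OF f g] h, symmetric]
        inl_copair[OF f g] inr_copair[OF f g])
qed

lemma copair_inl_inr:
  assumes "a \<in> Obj C" "b \<in> Obj C"
  shows "copair C K (inl K a b) (inr K a b) = ide C (cop K a b)"
  using assms
  by (intro copair_eqI[symmetric, where a = a and b = b and c = "cop K a b"])
    (auto intro: ide_in cop_in ide_right inl_in inr_in)

lemma cop_arr_eq:
  assumes "f \<in> hom C a a'" "g \<in> hom C b b'"
  shows "cop_arr C K f g = copair C K (f \<cdot> inl K a' b') (g \<cdot> inr K a' b')"
  using assms by (simp add: cop_arr_def hom_def)

lemma cop_arr_in:
  assumes f: "f \<in> hom C a a'" and g: "g \<in> hom C b b'"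
  shows "cop_arr C K f g \<in> hom C (cop K a b) (cop K a' b')"
  unfolding cop_arr_eq[OF f g] using hom_Obj[OF f] hom_Obj[OF g]
  by (intro copair_in seq_in[OF f] seq_in[OF g] inl_in inr_in)

text \<open>The left factor is \<open>cop_arr C K p q\<close> unfolded, so this is functoriality of
  the coproduct on composites; it holds because the injections slide past
  \<open>cop_arr C K f g\<close>.\<close>

lemma copair_cop_arr:
  assumes p: "p \<in> hom C x a" and q: "q \<in> hom C y b"
    and f: "f \<in> hom C a a'" and g: "g \<in> hom C b b'"
  shows "copair C K (p \<cdot> inl K a b) (q \<cdot> inr K a b) \<cdot> cop_arr C K f g =
    copair C K ((p \<cdot> f) \<cdot> inl K a' b') ((q \<cdot> g) \<cdot> inr K a' b')"
proof -
  note ob = hom_Obj[OF f] hom_Obj[OF g]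
  have i: "inl K a b \<in> hom C a (cop K a b)" "inr K a b \<in> hom C b (cop K a b)"
      "inl K a' b' \<in> hom C a' (cop K a' b')" "inr K a' b' \<in> hom C b' (cop K a' b')"
    using ob by (auto intro: inl_in inr_in)
  note s = cop_arr_in[OF f g]
  have "inl K a b \<cdot> cop_arr C K f g = f \<cdot> inl K a' b'"
    unfolding cop_arr_eq[OF f g] by (rule inl_copair[OF seq_in[OF f i(3)] seq_in[OF g i(4)]])
  moreover have "inr K a b \<cdot> cop_arr C K f g = g \<cdot> inr K a' b'"
    unfolding cop_arr_eq[OF f g] by (rule inr_copair[OF seq_in[OF f i(3)] seq_in[OF g i(4)]])
  ultimately show ?thesis
    by (simp add: copair_seq[OF seq_in[OF p i(1)] seq_in[OF q i(2)] s]
        seq_assoc[OF p i(1) s] seq_assoc[OF q i(2) s] seq_assoc[OF p f i(3)] seq_assoc[OF q g i(4)])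
qed

lemma endofunctor_const_plus:
  assumes a: "a \<in> Obj C" and "endofunctor C F"
  shows "endofunctor C (const_plus C K a F)"
proof -
  interpret F: endofunctor C F by fact
  note ia = ide_in[OF a]
  show ?thesis
  proof
    fix x assume x: "x \<in> Obj C"
    show "on_obj (const_plus C K a F) x \<in> Obj C"
      by (simp add: const_plus_def cop_in a x F.on_obj_in)
    have i: "inl K a (on_obj F x) \<in> hom C a (cop K a (on_obj F x))"
        "inr K a (on_obj F x) \<in> hom C (on_obj F x) (cop K a (on_obj F x))"
      by (intro inl_in inr_in a F.on_obj_in x)+
    show "on_arr (const_plus C K a F) (ide C x) = ide C (on_obj (const_plus C K a F) x)"
      by (simp add: const_plus_def F.on_arr_ide[OF x] cop_arr_eq[OF ia ide_in[OF F.on_obj_in[OF x]]]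
          ide_left[OF i(1)] ide_left[OF i(2)] copair_inl_inr a F.on_obj_in x)
  next
    fix f x y assume f: "f \<in> hom C x y"
    show "on_arr (const_plus C K a F) f \<in>
        hom C (on_obj (const_plus C K a F) x) (on_obj (const_plus C K a F) y)"
      using cop_arr_in[OF ia F.on_arr_in[OF f]] by (simp add: const_plus_def)
    fix g z assume g: "g \<in> hom C y z"
    show "on_arr (const_plus C K a F) (f \<cdot> g) =
        on_arr (const_plus C K a F) f \<cdot> on_arr (const_plus C K a F) g"
      unfolding const_plus_def endo.simps F.on_arr_seq[OF f g]
        cop_arr_eq[OF ia F.on_arr_in[OF f]]
        copair_cop_arr[OF ia F.on_arr_in[OF f] ia F.on_arr_in[OF g]]
        cop_arr_eq[OF ia seq_in[OF F.on_arr_in[OF f] F.on_arr_in[OF g]]]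
      by (simp add: ide_left[OF ia])
  qed
qed

end

section \<open>Final coalgebras: Lambek's lemma and primitive corecursion\<close>

context endofunctor
begin

text \<open>The identity is a coalgebra endomorphism too, and finality leaves room for only
  one.\<close>

lemma final_coalgebra_endo_eq_ide:
  assumes fin: "final_coalgebra C F t out" and h: "h \<in> coalgebra_hom C F t out t out"
  shows "h = ide C t"
proof -
  have t: "t \<in> Obj C" and out: "out \<in> hom C t (on_obj F t)"
    using fin by (auto simp: final_coalgebra_def coalgebra_def)
  have "ide C t \<in> coalgebra_hom C F t out t out"
    by (simp add: coalgebra_hom_def ide_in[OF t] on_arr_ide[OF t] ide_left[OF out] ide_right[OF out])
  moreover have "\<exists>!h. h \<in> coalgebra_hom C F t out t out"
    using fin by (simp add: final_coalgebra_def)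
  ultimately show ?thesis
    using h by blast
qed

text \<open>The inverse is the unique morphism \<open>g\<close> from the coalgebra
  \<open>F out\<close> on \<open>F t\<close>: \<open>out \<cdot> g\<close> is an endomorphism of the
  final coalgebra, and \<open>g \<cdot> out = F out \<cdot> F g = F (out \<cdot> g)\<close>.\<close>

theorem lambek:
  assumes fin: "final_coalgebra C F t out"
  shows "is_iso C out"
proof -
  have t: "t \<in> Obj C" and out: "out \<in> hom C t (on_obj F t)"
    using fin by (auto simp: final_coalgebra_def coalgebra_def)
  note Fout = on_arr_in[OF out]
  have "coalgebra C F (on_obj F t) (on_arr F out)"
    using t on_obj_in Fout by (simp add: coalgebra_def)
  then obtain g where "g \<in> coalgebra_hom C F (on_obj F t) (on_arr F out) t out"
    using fin unfolding final_coalgebra_def by blast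
  then have g: "g \<in> hom C (on_obj F t) t" and eq: "on_arr F out \<cdot> on_arr F g = g \<cdot> out"
    by (auto simp: coalgebra_hom_def)
  have "out \<cdot> g \<in> coalgebra_hom C F t out t out"
    by (simp add: coalgebra_hom_def seq_in[OF out g] on_arr_seq[OF out g] eq seq_assoc[OF out g out])
  then have 1: "out \<cdot> g = ide C t"
    by (rule final_coalgebra_endo_eq_ide[OF fin])
  have "g \<cdot> out = ide C (on_obj F t)"
    using on_arr_seq[OF out g] by (simp add: eq 1 on_arr_ide[OF t])
  with 1 g show ?thesis
    unfolding is_iso_def inverse_arrows_hom[OF out] by blast
qed

text \<open>The summand \<open>t\<close> lets \<open>d\<close> hand over a part of the result that
  already lies in \<open>t\<close> instead of a new state in \<open>x\<close>. Finality is applied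
  to \<open>cop K x t\<close>, not to \<open>x\<close>.\<close>

theorem primitive_corecursion:
  assumes "binary_coproducts C K" and fin: "final_coalgebra C F t out"
    and x: "x \<in> Obj C" and d: "d \<in> hom C x (on_obj F (cop K x t))"
  shows "\<exists>!h. h \<in> hom C x t \<and> h \<cdot> out = d \<cdot> on_arr F (copair C K h (ide C t))"
proof -
  interpret binary_coproducts C K by fact
  have t: "t \<in> Obj C" and out: "out \<in> hom C t (on_obj F t)"
    using fin by (auto simp: final_coalgebra_def coalgebra_def)
  note l = inl_in[OF x t] and r = inr_in[OF x t]
  note Fr = on_arr_in[OF r]
  \<comment> \<open>The second component lets the summand \<open>t\<close> evolve as in the final
    coalgebra: it makes \<open>inr K x t\<close> a coalgebra morphism from \<open>out\<close> to
    \<open>c\<close>.\<close>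
  define c where "c = copair C K d (out \<cdot> on_arr F (inr K x t))"
  note out_Fr = seq_in[OF out Fr]
  have c: "c \<in> hom C (cop K x t) (on_obj F (cop K x t))"
    unfolding c_def by (rule copair_in[OF d out_Fr])
  have "coalgebra C F (cop K x t) c"
    using c x t by (simp add: coalgebra_def cop_in)
  then have ex1: "\<exists>!m. m \<in> coalgebra_hom C F (cop K x t) c t out"
    using fin by (simp add: final_coalgebra_def)
  have c_seq: "c \<cdot> on_arr F m =
      copair C K (d \<cdot> on_arr F m) (out \<cdot> on_arr F (inr K x t \<cdot> m))"
    if m: "m \<in> hom C (cop K x t) t" for m
    unfolding c_def copair_seq[OF d out_Fr on_arr_in[OF m]]
    by (simp add: seq_assoc[OF out Fr on_arr_in[OF m]] on_arr_seq[OF r m])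
  show ?thesis
  proof (rule ex_ex1I)
    obtain m where m: "m \<in> hom C (cop K x t) t" and eq: "c \<cdot> on_arr F m = m \<cdot> out"
      using ex1 by (auto simp: coalgebra_hom_def)
    note dm = seq_in[OF d on_arr_in[OF m]] and om = seq_in[OF out on_arr_in[OF seq_in[OF r m]]]
    \<comment> \<open>The \<open>inr\<close> component of the coalgebra equation makes
      \<open>inr K x t \<cdot> m\<close> an endomorphism of the final coalgebra, hence the
      identity.\<close>
    have "out \<cdot> on_arr F (inr K x t \<cdot> m) = inr K x t \<cdot> (m \<cdot> out)"
      unfolding eq[symmetric] c_seq[OF m] by (rule inr_copair[OF dm om, symmetric])
    then have "inr K x t \<cdot> m \<in> coalgebra_hom C F t out t out"
      by (simp add: coalgebra_hom_def seq_in[OF r m] seq_assoc[OF r m out])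
    then have "inr K x t \<cdot> m = ide C t"
      by (rule final_coalgebra_endo_eq_ide[OF fin])
    then have m_eq: "m = copair C K (inl K x t \<cdot> m) (ide C t)"
      by (intro copair_eqI[OF x t m]) simp_all
    \<comment> \<open>The \<open>inl\<close> component is the corecursion equation for the witness
      \<open>inl K x t \<cdot> m\<close>, since \<open>m\<close> is its copairing with the
      identity.\<close>
    have "(inl K x t \<cdot> m) \<cdot> out = d \<cdot> on_arr F m"
      unfolding seq_assoc[OF l m out] eq[symmetric] c_seq[OF m] by (rule inl_copair[OF dm om])
    with m_eq seq_in[OF l m]
    show "\<exists>h. h \<in> hom C x t \<and> h \<cdot> out = d \<cdot> on_arr F (copair C K h (ide C t))"
      by metis
  next
    \<comment> \<open>For uniqueness: extended by the identity on \<open>t\<close>, every solution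
      is a coalgebra morphism from \<open>c\<close>. The first component is the assumption on
      \<open>h\<close>; the second holds because \<open>F\<close> preserves identities.\<close>
    have hom: "copair C K h (ide C t) \<in> coalgebra_hom C F (cop K x t) c t out"
      if h: "h \<in> hom C x t" and eq: "h \<cdot> out = d \<cdot> on_arr F (copair C K h (ide C t))" for h
    proof -
      note m = copair_in[OF h ide_in[OF t]]
      show ?thesis
        by (simp add: coalgebra_hom_def m c_seq[OF m] copair_seq[OF h ide_in[OF t] out] eq
            inr_copair[OF h ide_in[OF t]] on_arr_ide[OF t] ide_left[OF out] ide_right[OF out])
    qed
    fix h h'
    assume h: "h \<in> hom C x t \<and> h \<cdot> out = d \<cdot> on_arr F (copair C K h (ide C t))"
      and h': "h' \<in> hom C x t \<and> h' \<cdot> out = d \<cdot> on_arr F (copair C K h' (ide C t))"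
    then have "copair C K h (ide C t) = copair C K h' (ide C t)"
      using ex1 hom by blast
    then show "h = h'"
      using copair_eq_iff h h' ide_in[OF t] by blast
  qed
qed

end

section \<open>Tensoring, isomorphisms and distributivity\<close>

context monoidal_category
begin

text \<open>Tensoring with a fixed left factor is functorial by \<open>interchange\<close>, and
  functors preserve inverses.\<close>

lemma tens_iso_right:
  assumes z: "z \<in> Obj V" and f: "f \<in> hom V a b" and "is_iso V f"
  shows "is_iso V (ide V z \<boxtimes> f)"
proof -
  note iz = ide_in[OF z]
  obtain g where g: "g \<in> hom V b a" "f \<cdot> g = ide V a" "g \<cdot> f = ide V b"
    using assms(3) inverse_arrows_hom[OF f] by (auto simp: is_iso_def)
  have "(ide V z \<boxtimes> f) \<cdot> (ide V z \<boxtimes> g) = ide V (z \<otimes> a)"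
      "(ide V z \<boxtimes> g) \<cdot> (ide V z \<boxtimes> f) = ide V (z \<otimes> b)"
    using interchange[OF iz iz f g(1)] interchange[OF iz iz g(1) f] hom_Obj[OF f]
    by (simp_all add: g ide_left[OF iz] tens_arr_ide z)
  then show ?thesis
    unfolding is_iso_def inverse_arrows_hom[OF tens_arr_in[OF iz f]]
    using tens_arr_in[OF iz g(1)] by blast
qed

text \<open>By \<open>interchange\<close> this map factors as the canonical distributivity map
  followed by \<open>ide V z \<boxtimes> copair V K p q\<close>, and both factors are
  invertible.\<close>

lemma tens_copair_iso:
  assumes "binary_coproducts V K" and dist: "distributes_second V K" and z: "z \<in> Obj V"
    and p: "p \<in> hom V a t" and q: "q \<in> hom V b t" and iso: "is_iso V (copair V K p q)"
  shows "is_iso V (copair V K (ide V z \<boxtimes> p) (ide V z \<boxtimes> q))"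
proof -
  interpret binary_coproducts V K by fact
  have ab: "a \<in> Obj V" "b \<in> Obj V"
    using hom_Obj p q by auto
  note iz = ide_in[OF z] and pq = copair_in[OF p q]
  note l = tens_arr_in[OF iz inl_in[OF ab]] and r = tens_arr_in[OF iz inr_in[OF ab]]
  note zpq = tens_arr_in[OF iz pq]
  have "(ide V z \<boxtimes> inl K a b) \<cdot> (ide V z \<boxtimes> copair V K p q) = ide V z \<boxtimes> p"
      "(ide V z \<boxtimes> inr K a b) \<cdot> (ide V z \<boxtimes> copair V K p q) = ide V z \<boxtimes> q"
    using interchange[OF iz iz inl_in[OF ab] pq] interchange[OF iz iz inr_in[OF ab] pq]
    by (simp_all add: ide_left[OF iz] inl_copair[OF p q] inr_copair[OF p q])
  then have eq: "copair V K (ide V z \<boxtimes> p) (ide V z \<boxtimes> q) =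
      copair V K (ide V z \<boxtimes> inl K a b) (ide V z \<boxtimes> inr K a b) \<cdot> (ide V z \<boxtimes> copair V K p q)"
    by (simp add: copair_seq[OF l r zpq])
  have "is_iso V (copair V K (ide V z \<boxtimes> inl K a b) (ide V z \<boxtimes> inr K a b))"
    using dist z ab by (simp add: distributes_second_def)
  then show ?thesis
    unfolding eq by (rule iso_seq[OF copair_in[OF l r] zpq _ tens_iso_right[OF z pq iso]])
qed

end

section \<open>The substitution system on the final coalgebra\<close>

lemma (in pointed_strength) final_coalgebra_mhss:
  assumes "binary_coproducts V K" and dist: "distributes_second V K"
    and fin: "final_coalgebra V (const_plus V K \<I> H) t out"
    and \<eta>: "\<eta> \<in> hom V \<I> t" and \<tau>: "\<tau> \<in> hom V (on_obj H t) t"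
    and inv: "inverse_arrows V out (copair V K \<eta> \<tau>)"
  shows "mhss V H \<theta> t \<eta> \<tau>"
proof -
  interpret binary_coproducts V K by fact
  define F where "F = const_plus V K \<I> H"
  interpret F: endofunctor V F
    unfolding F_def using unit_in endofunctor_axioms by (rule endofunctor_const_plus)
  have F_obj: "on_obj F x = cop K \<I> (on_obj H x)"
    and F_arr: "on_arr F m = cop_arr V K (ide V \<I>) (on_arr H m)" for x m
    by (simp_all add: F_def const_plus_def)
  have t: "t \<in> Obj V" and out: "out \<in> hom V t (on_obj F t)"
    using fin by (auto simp: final_coalgebra_def coalgebra_def F_def)
  define \<beta> where "\<beta> = copair V K \<eta> \<tau>"
  have \<beta>: "\<beta> \<in> hom V (on_obj F t) t"
    unfolding \<beta>_def F_obj by (rule copair_in[OF \<eta> \<tau>])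
  have out_\<beta>: "out \<cdot> \<beta> = ide V t" "\<beta> \<cdot> out = ide V (on_obj F t)"
    using inv inverse_arrows_hom[OF out] by (auto simp: \<beta>_def)
  have iso_\<beta>: "is_iso V \<beta>"
    unfolding is_iso_def inverse_arrows_hom[OF \<beta>] using out out_\<beta> by blast
  have "\<exists>!h. h \<in> hom V (z \<otimes> t) t \<and> (ide V z \<boxtimes> \<eta>) \<cdot> h = runit V z \<cdot> f \<and>
      (ide V z \<boxtimes> \<tau>) \<cdot> h = \<theta> (z, e) t \<cdot> on_arr H h \<cdot> \<tau>"
    if z: "z \<in> Obj V" and e: "e \<in> hom V \<I> z" and f: "f \<in> hom V z t" for z e f
  proof -
    note iz = ide_in[OF z] and zt = tens_in[OF z t] and it = ide_in[OF t]
    note z\<eta> = tens_arr_in[OF iz \<eta>] and z\<tau> = tens_arr_in[OF iz \<tau>]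
    note l = inl_in[OF zt t] and r = inr_in[OF zt t]
    note Ir = inr_in[OF unit_in on_obj_in[OF t], folded F_obj]
    have st: "\<theta> (z, e) t \<in> hom V (z \<otimes> on_obj H t) (on_obj H (z \<otimes> t))"
      using strength_in[of "(z, e)" t] z e t by (simp add: ptd_obj_def)
    \<comment> \<open>Composing \<open>k\<close> with \<open>h\<close> pairs the left-hand sides of
      the two MHSS equations. Its inverse is a case distinction on the second tensor factor.\<close>
    define k where "k = copair V K (ide V z \<boxtimes> \<eta>) (ide V z \<boxtimes> \<tau>)"
    have k: "k \<in> hom V (cop K (z \<otimes> \<I>) (z \<otimes> on_obj H t)) (z \<otimes> t)"
      unfolding k_def by (rule copair_in[OF z\<eta> z\<tau>])
    have "is_iso V k"
      unfolding k_def using assms(1) dist z \<eta> \<tau> iso_\<beta>[unfolded \<beta>_def] by (rule tens_copair_iso)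
    then obtain k' where k': "k' \<in> hom V (z \<otimes> t) (cop K (z \<otimes> \<I>) (z \<otimes> on_obj H t))"
      and kk': "k \<cdot> k' = ide V (cop K (z \<otimes> \<I>) (z \<otimes> on_obj H t))" "k' \<cdot> k = ide V (z \<otimes> t)"
      by (auto simp: is_iso_def inverse_arrows_hom[OF k])
    note rf = seq_in[OF runit_in[OF z] f]
    note rfo = seq_in[OF rf out]
    \<comment> \<open>In the \<open>\<eta>\<close> case the result
      \<open>runit V z \<cdot> f\<close> is already in \<open>t\<close>: \<open>out\<close> unfolds
      it once, and \<open>inr\<close> marks what remains as finished.\<close>
    define d1 where "d1 = (runit V z \<cdot> f \<cdot> out) \<cdot> on_arr F (inr K (z \<otimes> t) t)"
    \<comment> \<open>In the \<open>\<tau>\<close> case the strength moves \<open>z\<close> under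
      \<open>H\<close>, and the inner \<open>inl\<close> marks \<open>z \<otimes> t\<close> as
      states for corecursive calls. The outer \<open>inr\<close> selects the summand
      \<open>H\<close> of \<open>\<I> + H\<close>.\<close>
    define d2 where "d2 = \<theta> (z, e) t \<cdot> on_arr H (inl K (z \<otimes> t) t) \<cdot>
      inr K \<I> (on_obj H (cop K (z \<otimes> t) t))"
    have d1: "d1 \<in> hom V (z \<otimes> \<I>) (on_obj F (cop K (z \<otimes> t) t))"
      unfolding d1_def by (rule seq_in[OF rfo F.on_arr_in[OF r]])
    note sl = seq_in[OF st on_arr_in[OF l]]
    note Ir' = inr_in[OF unit_in on_obj_in[OF cop_in[OF zt t]], folded F_obj]
    have d2: "d2 \<in> hom V (z \<otimes> on_obj H t) (on_obj F (cop K (z \<otimes> t) t))"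
      unfolding d2_def by (rule seq_in[OF sl Ir'])
    note d12 = copair_in[OF d1 d2]
    have "\<exists>!h. h \<in> hom V (z \<otimes> t) t \<and>
        h \<cdot> out = (k' \<cdot> copair V K d1 d2) \<cdot> on_arr F (copair V K h (ide V t))"
      using assms(1) fin[folded F_def] zt seq_in[OF k' d12] by (rule F.primitive_corecursion)
    moreover have "h \<cdot> out = (k' \<cdot> copair V K d1 d2) \<cdot> on_arr F (copair V K h (ide V t)) \<longleftrightarrow>
        (ide V z \<boxtimes> \<eta>) \<cdot> h = runit V z \<cdot> f \<and>
        (ide V z \<boxtimes> \<tau>) \<cdot> h = \<theta> (z, e) t \<cdot> on_arr H h \<cdot> \<tau>" (is "?L \<longleftrightarrow> ?R")
      if h: "h \<in> hom V (z \<otimes> t) t" for h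
    proof -
      define m where "m = copair V K h (ide V t)"
      have m: "m \<in> hom V (cop K (z \<otimes> t) t) t"
        and lm: "inl K (z \<otimes> t) t \<cdot> m = h" and rm: "inr K (z \<otimes> t) t \<cdot> m = ide V t"
        unfolding m_def by (rule copair_in[OF h it] inl_copair[OF h it] inr_copair[OF h it])+
      note Fm = F.on_arr_in[OF m] and Hm = on_arr_in[OF m]
      note sh = seq_in[OF st on_arr_in[OF h]]
      note shr = seq_in[OF sh Ir] and sht = seq_in[OF sh \<tau>]
      \<comment> \<open>Along \<open>inr\<close> the map \<open>m\<close> is the identity, so the
        finished part is kept unchanged.\<close>
      have d1m: "d1 \<cdot> on_arr F m = runit V z \<cdot> f \<cdot> out"
        unfolding d1_def seq_assoc[OF rfo F.on_arr_in[OF r] Fm] F.on_arr_seq[OF r m, symmetric]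
        by (simp add: rm F.on_arr_ide[OF t] ide_right[OF rfo])
      \<comment> \<open>Naturality of the right injection into \<open>\<I> + H\<close>.\<close>
      have "inr K \<I> (on_obj H (cop K (z \<otimes> t) t)) \<cdot> on_arr F m =
          on_arr H m \<cdot> inr K \<I> (on_obj H t)"
        unfolding F_arr cop_arr_eq[OF ide_in[OF unit_in] Hm]
        by (rule inr_copair[OF seq_in[OF ide_in[OF unit_in] inl_in[OF unit_in on_obj_in[OF t]]]
            seq_in[OF Hm inr_in[OF unit_in on_obj_in[OF t]]]])
      then have "d2 \<cdot> on_arr F m =
          \<theta> (z, e) t \<cdot> on_arr H (inl K (z \<otimes> t) t) \<cdot> (on_arr H m \<cdot> inr K \<I> (on_obj H t))"
        by (simp add: d2_def seq_assoc[OF sl Ir' Fm])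
      also have "\<dots> = \<theta> (z, e) t \<cdot> (on_arr H (inl K (z \<otimes> t) t) \<cdot> on_arr H m) \<cdot>
          inr K \<I> (on_obj H t)"
        by (simp add: seq_assoc[OF sl Hm Ir, symmetric] seq_assoc[OF st on_arr_in[OF l] Hm])
      \<comment> \<open>Along \<open>inl\<close> the map \<open>m\<close> is \<open>h\<close>, so
        each corecursive call becomes \<open>h\<close> under \<open>H\<close>.\<close>
      finally have d2m: "d2 \<cdot> on_arr F m = \<theta> (z, e) t \<cdot> on_arr H h \<cdot> inr K \<I> (on_obj H t)"
        by (simp add: on_arr_seq[OF l m, symmetric] lm)
      define w where "w = copair V K (runit V z \<cdot> f \<cdot> out)
        (\<theta> (z, e) t \<cdot> on_arr H h \<cdot> inr K \<I> (on_obj H t))"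
      have w: "w \<in> hom V (cop K (z \<otimes> \<I>) (z \<otimes> on_obj H t)) (on_obj F t)"
        unfolding w_def by (rule copair_in[OF rfo shr])
      have "(k' \<cdot> copair V K d1 d2) \<cdot> on_arr F m = k' \<cdot> w"
        by (simp add: seq_assoc[OF k' d12 Fm] copair_seq[OF d1 d2 Fm] d1m d2m w_def)
      \<comment> \<open>Here \<open>\<beta>\<close> cancels \<open>out\<close> in the first
        component and turns \<open>inr\<close> into \<open>\<tau>\<close> in the second, leaving the
        right-hand sides of the MHSS equations.\<close>
      moreover have "w \<cdot> \<beta> = copair V K (runit V z \<cdot> f) (\<theta> (z, e) t \<cdot> on_arr H h \<cdot> \<tau>)"
        using inr_copair[OF \<eta> \<tau>]
        by (simp add: w_def copair_seq[OF rfo shr \<beta>] seq_assoc[OF rf out \<beta>] out_\<beta> ide_right[OF rf]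
            seq_assoc[OF sh Ir \<beta>]) (simp add: \<beta>_def)
      moreover have "k \<cdot> h = copair V K ((ide V z \<boxtimes> \<eta>) \<cdot> h) ((ide V z \<boxtimes> \<tau>) \<cdot> h)"
        unfolding k_def by (rule copair_seq[OF z\<eta> z\<tau> h])
      \<comment> \<open>The inverse \<open>k'\<close> moves to the left as \<open>k\<close>, and
        \<open>out\<close> moves to the right as its inverse \<open>\<beta>\<close>.\<close>
      moreover have "h \<cdot> out = k' \<cdot> w \<longleftrightarrow> k \<cdot> h = w \<cdot> \<beta>"
        using inverse_seq_eq_iff[OF k k' kk' seq_in[OF h out] w]
          seq_inverse_eq_iff[OF out \<beta> out_\<beta> seq_in[OF k h] w]
        by (simp add: seq_assoc[OF k h out])
      ultimately show ?thesis
        using copair_eq_iff[OF seq_in[OF z\<eta> h] seq_in[OF z\<tau> h] rf sht] by (simp add: m_def)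
    qed
    \<comment> \<open>The equivalence is available only for \<open>h\<close> of the right type;
      \<open>conj_cong\<close> lets the typing conjunct justify rewriting the others.\<close>
    ultimately show ?thesis
      by (simp cong: conj_cong)
  qed
  with t \<eta> \<tau> show ?thesis
    by (simp add: mhss_def)
qed

text \<open>Writing the inverse of \<open>out\<close> as a copairing becomes two clauses: a suitable
  pair exists, so the implication is not vacuous, and every such pair yields an MHSS.\<close>

theorem theorem4:
  fixes V :: "('o, 'm, 's) moncat_scheme"
    and H :: "('o, 'm) endo"
    and \<theta> :: "'o \<times> 'm \<Rightarrow> 'o \<Rightarrow> 'm"
    and K :: "('o, 'm) coprods"
    and t :: 'o and out :: 'm
  assumes "monoidal_category V"
    and "endofunctor V H"
    and "pointed_strength V H \<theta>"
    and "binary_coproducts V K"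
    and "distributes_second V K"
    and "final_coalgebra V (const_plus V K (unit V) H) t out"
  shows "is_iso V out \<and>
    (\<exists>\<eta> \<in> hom V (unit V) t. \<exists>\<tau> \<in> hom V (on_obj H t) t. arr_inv V out = copair V K \<eta> \<tau>) \<and>
    (\<forall>\<eta> \<in> hom V (unit V) t. \<forall>\<tau> \<in> hom V (on_obj H t) t.
       arr_inv V out = copair V K \<eta> \<tau> \<longrightarrow> mhss V H \<theta> t \<eta> \<tau>)"
proof -
  interpret pointed_strength V H \<theta> by fact
  interpret binary_coproducts V K by fact
  have t: "t \<in> Obj V" and out: "out \<in> hom V t (cop K (unit V) (on_obj H t))"
    using assms(6) by (auto simp: final_coalgebra_def coalgebra_def const_plus_def)
  have iso: "is_iso V out"
    using endofunctor_const_plus[OF unit_in assms(2)] assms(6) by (rule endofunctor.lambek)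
  then have inv: "inverse_arrows V out (arr_inv V out)"
    using arr_inv_eq by (auto simp: is_iso_def)
  then have b: "arr_inv V out \<in> hom V (cop K (unit V) (on_obj H t)) t"
    by (simp add: inverse_arrows_hom[OF out])
  note ob = unit_in on_obj_in[OF t]
  \<comment> \<open>The witnesses are the restrictions of the inverse along the two
    injections.\<close>
  have "\<exists>\<eta> \<in> hom V (unit V) t. \<exists>\<tau> \<in> hom V (on_obj H t) t. arr_inv V out = copair V K \<eta> \<tau>"
    using copair_eqI[OF ob b refl refl] seq_in[OF inl_in[OF ob] b] seq_in[OF inr_in[OF ob] b]
    by blast
  moreover have "mhss V H \<theta> t \<eta> \<tau>"
    if "\<eta> \<in> hom V (unit V) t" "\<tau> \<in> hom V (on_obj H t) t" "arr_inv V out = copair V K \<eta> \<tau>" for \<eta> \<tau>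
    using final_coalgebra_mhss[OF assms(4-6) that(1,2)] inv that(3) by simp
  ultimately show ?thesis
    using iso by blast
qed

end
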